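(* Let $(X,\varphi,D,I)$ be a regular impulsive dynamical system on a compact metric space $(X,d)$ and let $\phi:\mathbb{R}_0^+\times X\to X$ be its associated regular impulsive semiflow. Then $$\bar{h}_{\mathrm{r}}(\phi)=\bar{h}_{\mathrm{s}}(\phi)=\hat{h}_{\mathrm{r}}(\phi)=\hat{h}_{\mathrm{s}}(\phi).$$
   Context: Impulsive systems. Let $(X,d)$ be a compact metric space, $\varphi:\mathbb{R}_0^+\times X\to X$ a continuous semiflow, $D\subset X$ a proper closed subset and $I:D\to X$ a continuous function. Define $\tau_1:X\to\mathbb{R}_0^+\cup\{\infty\}$ by $\tau_1(x)=\inf\{t>0:\varphi_t(x)\in D\}$ if $\varphi_t(x)\in D$ for some $t>0$, and $\tau_1(x)=+\infty$ otherwise. If $\tau_1(x)<\infty$ let $x^1=\varphi_{\tau_1(x)}(x)$. Inductively, if $x^n$ and $\tau_n(x)$ are defined and $\tau_n(x)<\infty$, let $\tau_{n+1}(x)=\tau_1(x)+\sum_{k=1}^n\tau_1(I(x^k))$ and, if $\tau_1(I(x^n))<\infty$, $x^{n+1}=\varphi_{\tau_1(I(x^n))}(I(x^n))$. Let $T(x)=\sup\{\tau_n(x):n\ge1\}$. The impulsive drift $\gamma_x:[0,T(x))\to X$ is given by $\gamma_x(t)=\varphi_t(x)$ for $t\in[0,\tau_1(x))$ and $\gamma_x(t)=\varphi_{t-\tau_n(x)}(I(x^n))$ for $t\in[\tau_n(x),\tau_{n+1}(x))$ when $\tau_n(x)<\infty$. $(X,\varphi,D,I)$ is an impulsive dynamical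 system if $\tau_1(x)>0$ and $T(x)=\infty$ for all $x\in X$; its associated impulsive semiflow is $\phi_t(x)=\gamma_x(t)$ (a semiflow, not necessarily continuous). Regularity. For $\eta>0$ put $D_\eta=\bigcup_{x\in D}\{\varphi_t(x):0<t<\eta\}$ and $X_\eta=X\setminus(D\cup D_\eta)$. The impulsive dynamical system $(X,\varphi,D,I)$ is regular if $I(D)\cap D=\emptyset$, $I$ is Lipschitz, and there exist $\eta>0$ and $\xi$ with $0<\xi<\eta/4$ such that (1) $D_\xi$ is open; (2) $\varphi_\xi(D_\xi)\subset X_\xi\setminus\varphi_\xi(D)$; (3) for all $x\in I(D)$ and $t\in(0,\xi]$, $\varphi_t(x)\notin I(D)$. The impulsive semiflow of a regular impulsive dynamical system is called a regular impulsive semiflow. Entropies. For a semiflow $\phi$ on $X$ and $\delta>0$ put $$d_\delta^1(x,y)=\inf\{d(\phi_{s_1}(x),\phi_{s_2}(y)):s_1,s_2\in[0,\delta)\},\qquad d_\delta(x,y)=\inf\{d(\phi_s(x),\phi_s(y)):s\in[0,\delta)\}.$$ Let $\rho$ be $d_\delta^1$ or $d_\delta$, and let $\varepsilon>0$, $T>0$. A set $F\subseteq X$ is $(\phi,T,\varepsilon,\delta)$-spanning for $\rho$ if for all $x\in X$ there exists $y\in F$ such that $\rho(\phi_t(x),\phi_t(y))<\varepsilon$ for all $t\in[0,T]$. A set $E\subseteq X$ is $(\phi,T,\varepsilon,\delta)$-separated for $\rho$ if for all $x,y\in E$ with $x\ne y$ there exists $t\in[0,T]$ such that $\rho(\phi_t(x),\phi_t(y))\ge\varepsilon$.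 Let $\bar r(\phi,T,\varepsilon,\delta)$ (resp. $\hat r(\phi,T,\varepsilon,\delta)$) be the infimum of the cardinalities of $(\phi,T,\varepsilon,\delta)$-spanning sets for $d_\delta^1$ (resp. $d_\delta$), and $\bar s(\phi,T,\varepsilon,\delta)$ (resp. $\hat s(\phi,T,\varepsilon,\delta)$) the supremum of the cardinalities of $(\phi,T,\varepsilon,\delta)$-separated sets for $d_\delta^1$ (resp. $d_\delta$). Define $$\bar h_{\mathrm r}(\phi)=\lim_{\delta\to0^+}\lim_{\varepsilon\to0^+}\limsup_{T\to+\infty}\frac1T\log\bar r(\phi,T,\varepsilon,\delta),$$ and $\bar h_{\mathrm s}(\phi),\hat h_{\mathrm r}(\phi),\hat h_{\mathrm s}(\phi)$ by the same formula with $\bar r$ replaced by $\bar s,\hat r,\hat s$ respectively, where $\log\infty=\infty$ (the limits exist in $[0,\infty]$ by monotonicity). *)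

theory Defs
  imports "HOL-Analysis.Analysis"
begin

section \<open>Impulsive dynamical systems\<close>

text \<open>The phase space is a whole type of class metric_space, assumed compact in the theorem.
  Times are reals; only the values of semiflows at times at least 0 are constrained, and only the
  values of the impulse map on the impulsive set matter.\<close>

locale continuous_semiflow =
  fixes \<phi> :: "real \<Rightarrow> 'a::metric_space \<Rightarrow> 'a"
  assumes semiflow_0: "\<phi> 0 x = x"
    and semiflow_add: "s \<ge> 0 \<Longrightarrow> t \<ge> 0 \<Longrightarrow> \<phi> (s + t) x = \<phi> s (\<phi> t x)"
    and semiflow_continuous: "continuous_on ({0..} \<times> UNIV) (\<lambda>(t, x). \<phi> t x)"

definition first_hit :: "(real \<Rightarrow> 'a::metric_space \<Rightarrow> 'a) \<Rightarrow> 'a set \<Rightarrow> 'a \<Rightarrow> ereal" where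
  "first_hit \<phi> D x =
     (if \<exists>t>0. \<phi> t x \<in> D then ereal (Inf {t. t > 0 \<and> \<phi> t x \<in> D}) else \<infinity>)"

text \<open>For n at least 1, \<open>impulse_point \<phi> D I x n\<close> is the n-th impulse point of x; it is
  meaningful only when \<open>impulse_time \<phi> D I x n\<close> is finite. The value at 0 is a dummy.\<close>

fun impulse_point ::
    "(real \<Rightarrow> 'a::metric_space \<Rightarrow> 'a) \<Rightarrow> 'a set \<Rightarrow> ('a \<Rightarrow> 'a) \<Rightarrow> 'a \<Rightarrow> nat \<Rightarrow> 'a" where
  "impulse_point \<phi> D I x 0 = x"
| "impulse_point \<phi> D I x (Suc 0) = \<phi> (real_of_ereal (first_hit \<phi> D x)) x"
| "impulse_point \<phi> D I x (Suc (Suc n)) =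
     (let y = I (impulse_point \<phi> D I x (Suc n))
      in \<phi> (real_of_ereal (first_hit \<phi> D y)) y)"

text \<open>Used for n at least 1. If one impulse time is infinite, so are all later ones, because the
  summands are nonnegative; hence those later values, left undefined on paper, do not affect the
  supremum below.\<close>

definition impulse_time ::
    "(real \<Rightarrow> 'a::metric_space \<Rightarrow> 'a) \<Rightarrow> 'a set \<Rightarrow> ('a \<Rightarrow> 'a) \<Rightarrow> 'a \<Rightarrow> nat \<Rightarrow> ereal" where
  "impulse_time \<phi> D I x n =
     first_hit \<phi> D x + (\<Sum>k=1..<n. first_hit \<phi> D (I (impulse_point \<phi> D I x k)))"

definition lifetime ::
    "(real \<Rightarrow> 'a::metric_space \<Rightarrow> 'a) \<Rightarrow> 'a set \<Rightarrow> ('a \<Rightarrow> 'a) \<Rightarrow> 'a \<Rightarrow> ereal" where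
  "lifetime \<phi> D I x = (SUP n\<in>{1..}. impulse_time \<phi> D I x n)"

text \<open>The impulsive drift, with the time argument first so that the same term is the impulsive
  semiflow. The intervals between consecutive impulse times are disjoint, so the index is unique;
  it exists for \<open>t < lifetime \<phi> D I x\<close>.\<close>

definition impulsive_semiflow ::
    "(real \<Rightarrow> 'a::metric_space \<Rightarrow> 'a) \<Rightarrow> 'a set \<Rightarrow> ('a \<Rightarrow> 'a) \<Rightarrow> real \<Rightarrow> 'a \<Rightarrow> 'a" where
  "impulsive_semiflow \<phi> D I t x =
     (if ereal t < first_hit \<phi> D x then \<phi> t x
      else let n = (THE n. n \<ge> 1 \<and> impulse_time \<phi> D I x n \<le> ereal t
                           \<and> ereal t < impulse_time \<phi> D I x (Suc n))
           in \<phi> (t - real_of_ereal (impulse_time \<phi> D I x n)) (I (impulse_point \<phi> D I x n)))"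

locale impulsive_system = continuous_semiflow \<phi>
  for \<phi> :: "real \<Rightarrow> 'a::metric_space \<Rightarrow> 'a" +
  fixes D :: "'a set" and I :: "'a \<Rightarrow> 'a"
  assumes closed_D: "closed D"
    and proper_D: "D \<noteq> UNIV"
    and continuous_I: "continuous_on D I"
    and first_hit_pos: "first_hit \<phi> D x > 0"
    and lifetime_infinite: "lifetime \<phi> D I x = \<infinity>"

definition D_tube :: "(real \<Rightarrow> 'a::metric_space \<Rightarrow> 'a) \<Rightarrow> 'a set \<Rightarrow> real \<Rightarrow> 'a set" where
  "D_tube \<phi> D \<eta> = (\<Union>x\<in>D. {\<phi> t x | t. 0 < t \<and> t < \<eta>})"

definition X_off :: "(real \<Rightarrow> 'a::metric_space \<Rightarrow> 'a) \<Rightarrow> 'a set \<Rightarrow> real \<Rightarrow> 'a set" where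
  "X_off \<phi> D \<eta> = UNIV - (D \<union> D_tube \<phi> D \<eta>)"

locale regular_impulsive_system = impulsive_system \<phi> D I
  for \<phi> :: "real \<Rightarrow> 'a::metric_space \<Rightarrow> 'a" and D :: "'a set" and I :: "'a \<Rightarrow> 'a" +
  assumes disjoint_I: "I ` D \<inter> D = {}"
    and lipschitz_I: "\<exists>L. L-lipschitz_on D I"
    and regular: "\<exists>\<eta> \<xi>. \<eta> > 0 \<and> 0 < \<xi> \<and> \<xi> < \<eta> / 4
      \<and> open (D_tube \<phi> D \<xi>)
      \<and> \<phi> \<xi> ` D_tube \<phi> D \<xi> \<subseteq> X_off \<phi> D \<xi> - \<phi> \<xi> ` D
      \<and> (\<forall>x\<in>I ` D. \<forall>t\<in>{0<..\<xi>}. \<phi> t x \<notin> I ` D)"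

section \<open>Entropies of a not necessarily continuous semiflow\<close>

definition dist_bar ::
    "(real \<Rightarrow> 'a::metric_space \<Rightarrow> 'a) \<Rightarrow> real \<Rightarrow> 'a \<Rightarrow> 'a \<Rightarrow> real" where
  "dist_bar \<psi> \<delta> x y = Inf {dist (\<psi> s\<^sub>1 x) (\<psi> s\<^sub>2 y) | s\<^sub>1 s\<^sub>2. s\<^sub>1 \<in> {0..<\<delta>} \<and> s\<^sub>2 \<in> {0..<\<delta>}}"

definition dist_hat ::
    "(real \<Rightarrow> 'a::metric_space \<Rightarrow> 'a) \<Rightarrow> real \<Rightarrow> 'a \<Rightarrow> 'a \<Rightarrow> real" where
  "dist_hat \<psi> \<delta> x y = Inf {dist (\<psi> s x) (\<psi> s y) | s. s \<in> {0..<\<delta>}}"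

definition spanning ::
    "('a \<Rightarrow> 'a \<Rightarrow> real) \<Rightarrow> (real \<Rightarrow> 'a \<Rightarrow> 'a) \<Rightarrow> real \<Rightarrow> real \<Rightarrow> 'a set \<Rightarrow> bool" where
  "spanning \<rho> \<psi> T \<epsilon> F \<longleftrightarrow> (\<forall>x. \<exists>y\<in>F. \<forall>t\<in>{0..T}. \<rho> (\<psi> t x) (\<psi> t y) < \<epsilon>)"

definition separated ::
    "('a \<Rightarrow> 'a \<Rightarrow> real) \<Rightarrow> (real \<Rightarrow> 'a \<Rightarrow> 'a) \<Rightarrow> real \<Rightarrow> real \<Rightarrow> 'a set \<Rightarrow> bool" where
  "separated \<rho> \<psi> T \<epsilon> E \<longleftrightarrow>
     (\<forall>x\<in>E. \<forall>y\<in>E. x \<noteq> y \<longrightarrow> (\<exists>t\<in>{0..T}. \<rho> (\<psi> t x) (\<psi> t y) \<ge> \<epsilon>))"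

definition ecard :: "'a set \<Rightarrow> enat" where
  "ecard A = (if finite A then enat (card A) else \<infinity>)"

definition span_num ::
    "('a \<Rightarrow> 'a \<Rightarrow> real) \<Rightarrow> (real \<Rightarrow> 'a \<Rightarrow> 'a) \<Rightarrow> real \<Rightarrow> real \<Rightarrow> enat" where
  "span_num \<rho> \<psi> T \<epsilon> = (INF F\<in>{F. spanning \<rho> \<psi> T \<epsilon> F}. ecard F)"

definition sep_num ::
    "('a \<Rightarrow> 'a \<Rightarrow> real) \<Rightarrow> (real \<Rightarrow> 'a \<Rightarrow> 'a) \<Rightarrow> real \<Rightarrow> real \<Rightarrow> enat" where
  "sep_num \<rho> \<psi> T \<epsilon> = (SUP E\<in>{E. separated \<rho> \<psi> T \<epsilon> E}. ecard E)"

text \<open>The argument 0 does not occur below: spanning sets are nonempty and singletons are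
  separated.\<close>

definition elog :: "enat \<Rightarrow> ereal" where
  "elog n = (case n of enat k \<Rightarrow> ereal (ln (real k)) | \<infinity> \<Rightarrow> \<infinity>)"

text \<open>The argument N gives the counting function in the order T, \<open>\<epsilon>\<close>, \<open>\<delta>\<close>. For the counting
  functions below both one-sided limits exist by monotonicity, so Lim denotes the actual limit.\<close>

definition growth_rate :: "(real \<Rightarrow> real \<Rightarrow> real \<Rightarrow> enat) \<Rightarrow> ereal" where
  "growth_rate N =
     Lim (at_right 0) (\<lambda>\<delta>. Lim (at_right 0) (\<lambda>\<epsilon>.
       Limsup at_top (\<lambda>T. ereal (1 / T) * elog (N T \<epsilon> \<delta>))))"

definition h_r_bar :: "(real \<Rightarrow> 'a::metric_space \<Rightarrow> 'a) \<Rightarrow> ereal" where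
  "h_r_bar \<psi> = growth_rate (\<lambda>T \<epsilon> \<delta>. span_num (dist_bar \<psi> \<delta>) \<psi> T \<epsilon>)"

definition h_s_bar :: "(real \<Rightarrow> 'a::metric_space \<Rightarrow> 'a) \<Rightarrow> ereal" where
  "h_s_bar \<psi> = growth_rate (\<lambda>T \<epsilon> \<delta>. sep_num (dist_bar \<psi> \<delta>) \<psi> T \<epsilon>)"

definition h_r_hat :: "(real \<Rightarrow> 'a::metric_space \<Rightarrow> 'a) \<Rightarrow> ereal" where
  "h_r_hat \<psi> = growth_rate (\<lambda>T \<epsilon> \<delta>. span_num (dist_hat \<psi> \<delta>) \<psi> T \<epsilon>)"

definition h_s_hat :: "(real \<Rightarrow> 'a::metric_space \<Rightarrow> 'a) \<Rightarrow> ereal" where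
  "h_s_hat \<psi> = growth_rate (\<lambda>T \<epsilon> \<delta>. sep_num (dist_hat \<psi> \<delta>) \<psi> T \<epsilon>)"

end

theory Submission
  imports Defs
begin

text \<open>
  All four quantities lie between the entropy from spanning sets for \<open>dist_bar\<close>, the smallest, and
  the one from separated sets for \<open>dist_hat\<close>, the largest: \<open>dist_bar \<le> dist_hat\<close>, and a separated
  set of maximal cardinality is spanning. So only one inequality has content, that the largest
  entropy is at most the smallest.

  The impulsive semiflow jumps, but rarely. Since \<open>I ` D\<close> and \<open>D\<close> are disjoint compact sets, the
  continuous semiflow needs at least some time \<open>\<beta> > 0\<close> to go from \<open>I ` D\<close> to \<open>D\<close>, so
  consecutive impulses of any orbit are at least \<open>\<beta>\<close> apart. Take \<open>4 * \<delta>' \<le> \<beta>\<close>, and cut a time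
  window of length \<open>4 * \<delta>'\<close> into four cells. An orbit has an impulse in at most one of them, so three
  given orbits have a common cell in which none of them jumps
  (\<open>three_orbits_common_free_cell\<close>). In that cell all three follow the continuous semiflow, which
  moves every point very little in time \<open>\<delta>'\<close>, uniformly by compactness. There the freedom to
  choose two unequal times in \<open>dist_bar\<close> is harmless: closeness for \<open>dist_bar\<close> gives genuine
  closeness at the left end of the cell. At this time the metric is available, with its triangle
  inequality, which in general fails for \<open>dist_bar\<close> and \<open>dist_hat\<close>.

  Apply this to two points \<open>x\<close>, \<open>y\<close> shadowed in \<open>dist_bar\<close> by the same point \<open>z\<close> of a spanning set:
  \<open>x\<close> and \<open>y\<close> are close in \<open>dist_hat\<close>
  (\<open>common_shadowing_imp_dist_hat_less\<close>). Hence distinct points of a separated set need distinct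
  points of a spanning set, and counting gives the missing inequality. The window may reach past
  the final time by a constant, which does not affect exponential growth rates.

  The semiflow law \<open>drift_add\<close> is used throughout: it makes the window around any time look like
  a window at time zero. It follows from the recursion \<open>drift_after_hit\<close>, which says
  that after the first impulse an orbit is the orbit of its post-impulse point.
\<close>

section \<open>Counting functions and their growth rates\<close>

text \<open>This monotonicity makes both one-sided limits in the growth rate suprema. It is asked for
  positive parameters only, because the infima defining the distances range over the
  empty set when \<open>\<delta> \<le> 0\<close>.\<close>

definition count_antimono :: "(real \<Rightarrow> real \<Rightarrow> real \<Rightarrow> enat) \<Rightarrow> bool" where
  "count_antimono N \<longleftrightarrow>
     (\<forall>T \<epsilon> \<epsilon>' \<delta> \<delta>'. 0 < \<epsilon> \<longrightarrow> \<epsilon> \<le> \<epsilon>' \<longrightarrow> 0 < \<delta> \<longrightarrow> \<delta> \<le> \<delta>' \<longrightarrow> N T \<epsilon>' \<delta>' \<le> N T \<epsilon> \<delta>)"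

lemma elog_mono: "m \<le> n \<Longrightarrow> elog m \<le> elog n"
proof (cases n)
  case (enat k)
  assume "m \<le> n"
  then obtain j where j: "m = enat j" "j \<le> k"
    using enat by (cases m) auto
  show ?thesis
    using j enat by (cases "j = 0"; cases "k = 0") (auto simp: elog_def)
qed (auto simp: elog_def)

lemma elog_nonneg: "0 \<le> elog n"
proof (cases n)
  case (enat k)
  then show ?thesis by (cases "k = 0") (auto simp: elog_def)
qed (auto simp: elog_def)

lemma Lim_at_right_antimono:
  fixes f :: "real \<Rightarrow> ereal"
  assumes "\<And>x y. a < x \<Longrightarrow> x \<le> y \<Longrightarrow> f y \<le> f x"
  shows "Lim (at_right a) f = (SUP x\<in>{a<..}. f x)"
proof (rule tendsto_Lim)
  show "(f \<longlongrightarrow> (SUP x\<in>{a<..}. f x)) (at_right a)"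
  proof (rule order_tendstoI)
    fix c assume "c < (SUP x\<in>{a<..}. f x)"
    then obtain b where b: "a < b" "c < f b"
      by (auto simp: less_SUP_iff)
    have "\<forall>\<^sub>F x in at_right a. x \<in> {a<..<b}"
      by (rule eventually_at_right_real) (use b in simp)
    then show "\<forall>\<^sub>F x in at_right a. c < f x"
      by eventually_elim (use b assms in \<open>auto intro: less_le_trans\<close>)
  next
    fix c assume "(SUP x\<in>{a<..}. f x) < c"
    then have "f x < c" if "a < x" for x
      using that by (meson SUP_upper greaterThan_iff le_less_trans)
    then show "\<forall>\<^sub>F x in at_right a. f x < c"
      by (simp add: eventually_at_right_less eventually_mono[OF eventually_at_right_less])
  qed
qed simp

text \<open>If \<open>g T \<le> A * T\<close> for large \<open>T\<close>, then \<open>f T / T \<le> A * (1 + c / T)\<close>, and the factor tends to 1.\<close>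

lemma Limsup_shift_le:
  fixes f g :: "real \<Rightarrow> ereal"
  assumes le: "\<And>T. 0 < T \<Longrightarrow> f T \<le> g (T + c)" and nonneg: "\<And>T. 0 \<le> g T"
  shows "Limsup at_top (\<lambda>T. ereal (1 / T) * f T) \<le> Limsup at_top (\<lambda>T. ereal (1 / T) * g T)"
    (is "_ \<le> ?G")
proof (rule dense_ge)
  fix a assume a: "?G < a"
  have "0 \<le> ?G"
  proof (rule le_Limsup)
    show "\<forall>\<^sub>F T in at_top. 0 \<le> ereal (1 / T) * g T"
      using eventually_gt_at_top[of "0::real"]
      by eventually_elim (use nonneg in auto)
  qed simp
  show "Limsup at_top (\<lambda>T. ereal (1 / T) * f T) \<le> a"
  proof (cases a)
    case (real A)
    have "A \<ge> 0" using a \<open>0 \<le> ?G\<close> real by (metis ereal_less_eq(5) less_imp_le order_trans)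
    have "\<forall>\<^sub>F T in at_top. ereal (1 / T) * g T < a"
      using a by (rule Limsup_lessD)
    then have "\<forall>\<^sub>F T in at_top. ereal (1 / (T + c)) * g (T + c) < a"
      by (rule eventually_compose_filterlim)
        (use filterlim_tendsto_add_at_top[OF tendsto_const[of c] filterlim_ident] in \<open>simp add: add.commute\<close>)
    moreover have "\<forall>\<^sub>F T in at_top. T > max 0 (-c)"
      by (rule eventually_gt_at_top)
    ultimately have ev: "\<forall>\<^sub>F T in at_top. ereal (1 / T) * f T \<le> ereal (A * (1 + c / T))"
    proof eventually_elim
      case (elim T)
      then obtain G where G: "g (T + c) = ereal G"
        using nonneg[of "T + c"] real by (cases "g (T + c)") auto
      have "G / (T + c) < A" using elim G real by simp
      then have "G \<le> A * (T + c)" using elim by (simp add: pos_divide_less_eq)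
      then have "1 / T * G \<le> A * (1 + c / T)"
        using elim by (simp add: field_simps)
      moreover have "ereal (1 / T) * f T \<le> ereal (1 / T) * ereal G"
        using le[of T] G elim by (intro ereal_mult_left_mono) auto
      ultimately show ?case by (metis ereal_less_eq(3) order_trans times_ereal.simps(1))
    qed
    have "((\<lambda>T. ereal (A * (1 + c / T))) \<longlongrightarrow> ereal (A * (1 + 0))) at_top"
      by (intro tendsto_intros tendsto_divide_0[OF tendsto_const] filterlim_at_top_imp_at_infinity
          filterlim_ident)
    then have "Limsup at_top (\<lambda>T. ereal (A * (1 + c / T))) = a"
      using real by (simp add: lim_imp_Limsup)
    with Limsup_mono[OF ev] show ?thesis by simp
  qed (use a \<open>0 \<le> ?G\<close> in auto)
qed

lemma growth_rate_eq_SUP: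
  assumes "count_antimono N"
  shows "growth_rate N = (SUP \<delta>\<in>{0<..}. SUP \<epsilon>\<in>{0<..}.
    Limsup at_top (\<lambda>T. ereal (1 / T) * elog (N T \<epsilon> \<delta>)))"
proof -
  let ?L = "\<lambda>\<delta> \<epsilon>. Limsup at_top (\<lambda>T. ereal (1 / T) * elog (N T \<epsilon> \<delta>))"
  have mono: "?L \<delta>' \<epsilon>' \<le> ?L \<delta> \<epsilon>" if "0 < \<epsilon>" "\<epsilon> \<le> \<epsilon>'" "0 < \<delta>" "\<delta> \<le> \<delta>'" for \<epsilon> \<epsilon>' \<delta> \<delta>'
  proof (rule Limsup_mono)
    show "\<forall>\<^sub>F T in at_top. ereal (1 / T) * elog (N T \<epsilon>' \<delta>') \<le> ereal (1 / T) * elog (N T \<epsilon> \<delta>)"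
      using eventually_gt_at_top[of "0::real"]
    proof eventually_elim
      case (elim T)
      then show ?case
        using assms that by (intro ereal_mult_left_mono elog_mono) (auto simp: count_antimono_def)
    qed
  qed
  have inner: "Lim (at_right 0) (?L \<delta>) = (SUP \<epsilon>\<in>{0<..}. ?L \<delta> \<epsilon>)" if "0 < \<delta>" for \<delta>
    using that by (intro Lim_at_right_antimono mono) auto
  have "growth_rate N = (SUP \<delta>\<in>{0<..}. Lim (at_right 0) (?L \<delta>))"
    unfolding growth_rate_def
  proof (rule Lim_at_right_antimono)
    fix \<delta> \<delta>' :: real assume "0 < \<delta>" "\<delta> \<le> \<delta>'"
    then have "(SUP \<epsilon>\<in>{0<..}. ?L \<delta>' \<epsilon>) \<le> (SUP \<epsilon>\<in>{0<..}. ?L \<delta> \<epsilon>)"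
      by (intro SUP_subset_mono mono) auto
    then show "Lim (at_right 0) (?L \<delta>') \<le> Lim (at_right 0) (?L \<delta>)"
      using \<open>0 < \<delta>\<close> \<open>\<delta> \<le> \<delta>'\<close> by (simp add: inner)
  qed
  then show ?thesis by (simp add: inner)
qed

text \<open>Both limits being suprema, the smaller parameters \<open>\<epsilon>'\<close> and \<open>\<delta>'\<close> may depend on \<open>\<epsilon>\<close> and \<open>\<delta>\<close> in
  any way.\<close>

lemma growth_rate_le:
  assumes "count_antimono M" "count_antimono N"
    and cmp: "\<And>\<epsilon> \<delta>. 0 < \<epsilon> \<Longrightarrow> 0 < \<delta> \<Longrightarrow>
      \<exists>\<epsilon>'>0. \<exists>\<delta>'>0. \<exists>c. \<forall>T>0. M T \<epsilon> \<delta> \<le> N (T + c) \<epsilon>' \<delta>'"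
  shows "growth_rate M \<le> growth_rate N"
proof -
  let ?L = "\<lambda>N \<delta> \<epsilon>. Limsup at_top (\<lambda>T. ereal (1 / T) * elog (N T \<epsilon> \<delta>))"
  have "?L M \<delta> \<epsilon> \<le> (SUP \<delta>\<in>{0<..}. SUP \<epsilon>\<in>{0<..}. ?L N \<delta> \<epsilon>)" if "0 < \<delta>" "0 < \<epsilon>" for \<delta> \<epsilon> :: real
  proof -
    obtain \<epsilon>' \<delta>' c where *: "0 < \<epsilon>'" "0 < \<delta>'" "\<And>T. T > 0 \<Longrightarrow> M T \<epsilon> \<delta> \<le> N (T + c) \<epsilon>' \<delta>'"
      using cmp[OF \<open>0 < \<epsilon>\<close> \<open>0 < \<delta>\<close>] by blast
    have "?L M \<delta> \<epsilon> \<le> ?L N \<delta>' \<epsilon>'"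
      by (rule Limsup_shift_le[where c = c]) (auto intro: elog_mono * elog_nonneg)
    also have "\<dots> \<le> (SUP \<epsilon>\<in>{0<..}. ?L N \<delta>' \<epsilon>)"
      by (rule SUP_upper) (use * in simp)
    also have "\<dots> \<le> (SUP \<delta>\<in>{0<..}. SUP \<epsilon>\<in>{0<..}. ?L N \<delta> \<epsilon>)"
      using * by (intro SUP_upper[where f = "\<lambda>\<delta>. SUP \<epsilon>\<in>{0<..}. ?L N \<delta> \<epsilon>"]) simp
    finally show ?thesis .
  qed
  then show ?thesis
    using assms by (simp add: growth_rate_eq_SUP SUP_le_iff)
qed

lemma growth_rate_mono:
  assumes "count_antimono M" "count_antimono N"
    and "\<And>T \<epsilon> \<delta>. 0 < T \<Longrightarrow> 0 < \<epsilon> \<Longrightarrow> 0 < \<delta> \<Longrightarrow> M T \<epsilon> \<delta> \<le> N T \<epsilon> \<delta>"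
  shows "growth_rate M \<le> growth_rate N"
  by (rule growth_rate_le[OF assms(1,2)]) (metis add.right_neutral assms(3))

section \<open>Spanning and separated sets\<close>

lemma span_num_mono:
  assumes "\<And>x y. \<rho> x y \<le> \<rho>' x y" "\<epsilon> \<le> \<epsilon>'"
  shows "span_num \<rho> \<psi> T \<epsilon>' \<le> span_num \<rho>' \<psi> T \<epsilon>"
proof -
  have "spanning \<rho> \<psi> T \<epsilon>' F" if "spanning \<rho>' \<psi> T \<epsilon> F" for F
    using that assms unfolding spanning_def by (meson le_less_trans less_le_trans)
  then show ?thesis
    unfolding span_num_def by (intro INF_superset_mono) auto
qed

lemma sep_num_mono:
  assumes "\<And>x y. \<rho> x y \<le> \<rho>' x y" "\<epsilon> \<le> \<epsilon>'"
  shows "sep_num \<rho> \<psi> T \<epsilon>' \<le> sep_num \<rho>' \<psi> T \<epsilon>"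
proof -
  have "separated \<rho>' \<psi> T \<epsilon> F" if "separated \<rho> \<psi> T \<epsilon>' F" for F
    using that assms unfolding separated_def by (meson order_trans)
  then show ?thesis
    unfolding sep_num_def by (intro SUP_subset_mono) auto
qed

text \<open>If the separated sets have bounded cardinality, one of largest cardinality is spanning, since
  a point that it fails to shadow could be added to it.\<close>

lemma span_num_le_sep_num:
  assumes refl: "\<And>x. \<rho> x x < \<epsilon>" and sym: "\<And>x y. \<rho> x y = \<rho> y x" and "0 \<le> T"
  shows "span_num \<rho> \<psi> T \<epsilon> \<le> sep_num \<rho> \<psi> T \<epsilon>"
proof (cases "sep_num \<rho> \<psi> T \<epsilon>")
  case (enat k)
  have bound: "finite E \<and> card E \<le> k" if "separated \<rho> \<psi> T \<epsilon> E" for E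
  proof -
    have "ecard E \<le> enat k"
      using that enat unfolding sep_num_def by (metis SUP_upper mem_Collect_eq)
    then show ?thesis by (auto simp: ecard_def split: if_splits)
  qed
  have "separated \<rho> \<psi> T \<epsilon> {}" by (simp add: separated_def)
  then have "\<exists>E. separated \<rho> \<psi> T \<epsilon> E \<and> (\<forall>E'. separated \<rho> \<psi> T \<epsilon> E' \<longrightarrow> card E' \<le> card E)"
    by (rule ex_has_greatest_nat[where b = "Suc k"]) (simp add: bound le_imp_less_Suc)
  then obtain E where E: "separated \<rho> \<psi> T \<epsilon> E"
    and max: "\<And>E'. separated \<rho> \<psi> T \<epsilon> E' \<Longrightarrow> card E' \<le> card E"
    by metis
  have "spanning \<rho> \<psi> T \<epsilon> E"
    unfolding spanning_def
  proof (rule allI, rule ccontr)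
    fix x assume "\<not> (\<exists>y\<in>E. \<forall>t\<in>{0..T}. \<rho> (\<psi> t x) (\<psi> t y) < \<epsilon>)"
    then have far: "\<forall>y\<in>E. \<exists>t\<in>{0..T}. \<epsilon> \<le> \<rho> (\<psi> t x) (\<psi> t y)"
      by (meson not_le)
    then have "x \<notin> E" using refl by (meson not_le)
    have "separated \<rho> \<psi> T \<epsilon> (insert x E)"
      using E far sym unfolding separated_def by (metis insert_iff)
    then show False
      using max[of "insert x E"] bound[OF E] \<open>x \<notin> E\<close> by simp
  qed
  then have "span_num \<rho> \<psi> T \<epsilon> \<le> ecard E"
    unfolding span_num_def by (intro INF_lower) simp
  also have "\<dots> \<le> sep_num \<rho> \<psi> T \<epsilon>"
    unfolding sep_num_def using E by (intro SUP_upper) simp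
  finally show ?thesis .
qed simp

text \<open>The hypothesis stands in for the triangle inequality: two points shadowed by a common
  point are not separated, so sending each point of a separated set to a point that shadows it
  is injective.\<close>

lemma sep_num_le_span_num:
  assumes "\<And>x y z. \<forall>t\<in>{0..T'}. \<rho>' (\<psi> t x) (\<psi> t z) < \<epsilon>' \<Longrightarrow>
      \<forall>t\<in>{0..T'}. \<rho>' (\<psi> t y) (\<psi> t z) < \<epsilon>' \<Longrightarrow> \<forall>t\<in>{0..T}. \<rho> (\<psi> t x) (\<psi> t y) < \<epsilon>"
  shows "sep_num \<rho> \<psi> T \<epsilon> \<le> span_num \<rho>' \<psi> T' \<epsilon>'"
  unfolding sep_num_def span_num_def
proof (intro SUP_least INF_greatest)
  fix E F assume "E \<in> {E. separated \<rho> \<psi> T \<epsilon> E}" "F \<in> {F. spanning \<rho>' \<psi> T' \<epsilon>' F}"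
  then have E: "separated \<rho> \<psi> T \<epsilon> E" and F: "spanning \<rho>' \<psi> T' \<epsilon>' F" by auto
  obtain c where c: "\<And>x. c x \<in> F \<and> (\<forall>t\<in>{0..T'}. \<rho>' (\<psi> t x) (\<psi> t (c x)) < \<epsilon>')"
    using F unfolding spanning_def by metis
  have "inj_on c E"
  proof (rule inj_onI, rule ccontr)
    fix x y assume "x \<in> E" "y \<in> E" "c x = c y" "x \<noteq> y"
    moreover have "\<forall>t\<in>{0..T}. \<rho> (\<psi> t x) (\<psi> t y) < \<epsilon>"
      using assms[of x "c x" y] c[of x] c[of y] \<open>c x = c y\<close> by simp
    ultimately show False
      using E unfolding separated_def by (meson not_le)
  qed
  moreover have "c ` E \<subseteq> F" using c by blast
  ultimately show "ecard E \<le> ecard F"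
    by (auto simp: ecard_def intro: card_inj_on_le dest: inj_on_finite)
qed

lemma dist_bar_less_iff:
  assumes "0 < \<delta>"
  shows "dist_bar \<psi> \<delta> x y < \<epsilon> \<longleftrightarrow>
    (\<exists>s\<^sub>1\<in>{0..<\<delta>}. \<exists>s\<^sub>2\<in>{0..<\<delta>}. dist (\<psi> s\<^sub>1 x) (\<psi> s\<^sub>2 y) < \<epsilon>)"
proof -
  have "bdd_below {dist (\<psi> s\<^sub>1 x) (\<psi> s\<^sub>2 y) | s\<^sub>1 s\<^sub>2. s\<^sub>1 \<in> {0..<\<delta>} \<and> s\<^sub>2 \<in> {0..<\<delta>}}"
    by (rule bdd_belowI[of _ 0]) auto
  moreover have "{dist (\<psi> s\<^sub>1 x) (\<psi> s\<^sub>2 y) | s\<^sub>1 s\<^sub>2. s\<^sub>1 \<in> {0..<\<delta>} \<and> s\<^sub>2 \<in> {0..<\<delta>}} \<noteq> {}"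
    using assms by (auto intro!: exI[of _ 0])
  ultimately show ?thesis
    unfolding dist_bar_def by (subst cInf_less_iff) blast+
qed

lemma dist_hat_less_iff:
  assumes "0 < \<delta>"
  shows "dist_hat \<psi> \<delta> x y < \<epsilon> \<longleftrightarrow> (\<exists>s\<in>{0..<\<delta>}. dist (\<psi> s x) (\<psi> s y) < \<epsilon>)"
proof -
  have "bdd_below {dist (\<psi> s x) (\<psi> s y) | s. s \<in> {0..<\<delta>}}"
    by (rule bdd_belowI[of _ 0]) auto
  moreover have "{dist (\<psi> s x) (\<psi> s y) | s. s \<in> {0..<\<delta>}} \<noteq> {}"
    using assms by (auto intro!: exI[of _ 0])
  ultimately show ?thesis
    unfolding dist_hat_def by (subst cInf_less_iff) blast+
qed

lemma dist_bar_antimono: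
  assumes "0 < \<delta>" "\<delta> \<le> \<delta>'"
  shows "dist_bar \<psi> \<delta>' x y \<le> dist_bar \<psi> \<delta> x y"
proof (rule dense_ge)
  fix e assume "dist_bar \<psi> \<delta> x y < e"
  then obtain s\<^sub>1 s\<^sub>2 where "s\<^sub>1 \<in> {0..<\<delta>}" "s\<^sub>2 \<in> {0..<\<delta>}" "dist (\<psi> s\<^sub>1 x) (\<psi> s\<^sub>2 y) < e"
    using dist_bar_less_iff[OF assms(1)] by blast
  moreover have "{0..<\<delta>} \<subseteq> {0..<\<delta>'}" using assms by auto
  ultimately have "dist_bar \<psi> \<delta>' x y < e"
    using dist_bar_less_iff[of \<delta>' \<psi> x y e] assms by force
  then show "dist_bar \<psi> \<delta>' x y \<le> e" by simp
qed

lemma dist_hat_antimono: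
  assumes "0 < \<delta>" "\<delta> \<le> \<delta>'"
  shows "dist_hat \<psi> \<delta>' x y \<le> dist_hat \<psi> \<delta> x y"
proof (rule dense_ge)
  fix e assume "dist_hat \<psi> \<delta> x y < e"
  then obtain s where "s \<in> {0..<\<delta>}" "dist (\<psi> s x) (\<psi> s y) < e"
    using dist_hat_less_iff[OF assms(1)] by blast
  moreover have "{0..<\<delta>} \<subseteq> {0..<\<delta>'}" using assms by auto
  ultimately have "dist_hat \<psi> \<delta>' x y < e"
    using dist_hat_less_iff[of \<delta>' \<psi> x y e] assms by force
  then show "dist_hat \<psi> \<delta>' x y \<le> e" by simp
qed

lemma dist_bar_le_dist_hat:
  assumes "0 < \<delta>"
  shows "dist_bar \<psi> \<delta> x y \<le> dist_hat \<psi> \<delta> x y"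
proof (rule dense_ge)
  fix e assume "dist_hat \<psi> \<delta> x y < e"
  then have "dist_bar \<psi> \<delta> x y < e"
    using dist_bar_less_iff[OF assms, of \<psi> x y e] dist_hat_less_iff[OF assms, of \<psi> x y e] by blast
  then show "dist_bar \<psi> \<delta> x y \<le> e" by simp
qed

lemma dist_bar_commute: "dist_bar \<psi> \<delta> x y = dist_bar \<psi> \<delta> y x"
  unfolding dist_bar_def by (rule arg_cong[where f = Inf]) (auto simp: dist_commute; metis dist_commute)

lemma dist_hat_commute: "dist_hat \<psi> \<delta> x y = dist_hat \<psi> \<delta> y x"
  by (simp add: dist_hat_def dist_commute)

lemma dist_hat_refl_less: "0 < \<delta> \<Longrightarrow> 0 < \<epsilon> \<Longrightarrow> dist_hat \<psi> \<delta> x x < \<epsilon>"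
  by (auto simp: dist_hat_less_iff intro!: bexI[of _ 0])

lemma dist_bar_refl_less: "0 < \<delta> \<Longrightarrow> 0 < \<epsilon> \<Longrightarrow> dist_bar \<psi> \<delta> x x < \<epsilon>"
  using dist_bar_le_dist_hat dist_hat_refl_less by (metis le_less_trans)

section \<open>The impulsive semiflow\<close>

context impulsive_system
begin

abbreviation hit :: "'a \<Rightarrow> ereal" where "hit \<equiv> first_hit \<phi> D"

abbreviation drift :: "real \<Rightarrow> 'a \<Rightarrow> 'a" where "drift \<equiv> impulsive_semiflow \<phi> D I"

text \<open>The point at which an orbit restarts after its first impulse; a junk value when
  there is no impulse.\<close>

definition jump :: "'a \<Rightarrow> 'a" where "jump x = I (\<phi> (real_of_ereal (hit x)) x)"

lemma continuous_flow_time: "continuous_on {0..} (\<lambda>t. \<phi> t x)"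
proof -
  have "continuous_on {0..} (\<lambda>t. (t, x))" by (intro continuous_intros)
  then show ?thesis
    using continuous_on_compose2[OF semiflow_continuous, of "{0..}" "\<lambda>t. (t, x)"] by auto
qed

lemma hit_le: "0 < t \<Longrightarrow> \<phi> t x \<in> D \<Longrightarrow> hit x \<le> ereal t"
  unfolding first_hit_def by (auto intro!: cInf_lower bdd_belowI[of _ 0])

text \<open>The infimum of the hitting times is itself a hitting time: being positive, it is a limit of
  times at which the orbit is in the closed set \<open>D\<close>, even though the set of positive times is not closed.\<close>

lemma hit_finite:
  assumes "hit x = ereal r"
  shows hit_finite_pos: "0 < r" and hit_finite_mem: "\<phi> r x \<in> D"
proof -
  let ?S = "{t. t > 0 \<and> \<phi> t x \<in> D}"
  show "0 < r" using first_hit_pos[of x] assms by simp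
  have ne: "?S \<noteq> {}" and r: "r = Inf ?S"
    using assms by (auto simp: first_hit_def split: if_splits)
  have bdd: "bdd_below ?S" by (auto intro!: bdd_belowI[of _ 0])
  have "r \<in> closure ?S" unfolding r by (rule closure_contains_Inf[OF ne bdd])
  moreover have "closed ({0..} \<inter> (\<lambda>t. \<phi> t x) -` D)"
    by (intro continuous_closed_preimage continuous_flow_time closed_D) simp
  moreover have "?S \<subseteq> {0..} \<inter> (\<lambda>t. \<phi> t x) -` D" by auto
  ultimately show "\<phi> r x \<in> D" by (metis (no_types, lifting) IntD2 closure_minimal subsetD vimageD)
qed

lemma hit_flow:
  assumes "0 \<le> t" "ereal t < hit x"
  shows "hit (\<phi> t x) = hit x - ereal t"
proof (rule antisym)
  show "hit (\<phi> t x) \<le> hit x - ereal t"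
  proof (cases "hit x")
    case (real r)
    then have "\<phi> (r - t) (\<phi> t x) \<in> D"
      using hit_finite_mem[OF real] assms semiflow_add[of "r - t" t x] by simp
    then show ?thesis using hit_le[of "r - t" "\<phi> t x"] real assms by simp
  qed (use assms in auto)
  show "hit x - ereal t \<le> hit (\<phi> t x)"
  proof (cases "hit (\<phi> t x)")
    case (real r)
    then have "\<phi> (r + t) x \<in> D"
      using hit_finite_mem[OF real] hit_finite_pos[OF real] assms semiflow_add[of r t x] by simp
    then have "hit x \<le> ereal (r + t)"
      using hit_le[of "r + t" x] hit_finite_pos[OF real] assms by simp
    then show ?thesis using real by (cases "hit x") auto
  qed (use first_hit_pos[of "\<phi> t x"] in auto)
qed

lemma jump_flow:
  assumes "0 \<le> t" "ereal t < hit x" "hit x = ereal r"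
  shows "jump (\<phi> t x) = jump x"
  using hit_flow[OF assms(1,2)] semiflow_add[of "r - t" t x] assms by (simp add: jump_def)

lemma impulse_point_Suc: "impulse_point \<phi> D I x (Suc (Suc n)) = impulse_point \<phi> D I (jump x) (Suc n)"
proof (induction n)
  case 0
  show ?case by (simp add: jump_def Let_def)
next
  case (Suc n)
  show ?case by (subst (1 2) impulse_point.simps(3)) (simp only: Suc)
qed

lemma impulse_time_1: "impulse_time \<phi> D I x (Suc 0) = hit x"
  by (simp add: impulse_time_def)

text \<open>The impulse times are defined by adding gaps at the end; here the first gap is split off
  instead, to allow induction along an orbit from its start.\<close>

lemma impulse_time_Suc:
  "impulse_time \<phi> D I x (Suc (Suc n)) = hit x + impulse_time \<phi> D I (jump x) (Suc n)"
proof (induction n)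
  case 0
  show ?case by (simp add: impulse_time_def jump_def)
next
  case (Suc n)
  have step: "impulse_time \<phi> D I z (Suc (Suc k)) =
      impulse_time \<phi> D I z (Suc k) + hit (I (impulse_point \<phi> D I z (Suc k)))" for z k
    by (simp add: impulse_time_def add.assoc)
  show ?case
    by (subst (1 2) step) (simp only: Suc impulse_point_Suc add.assoc)
qed

lemma impulse_time_mono: "impulse_time \<phi> D I x m \<le> impulse_time \<phi> D I x n" if "m \<le> n"
  unfolding impulse_time_def using that first_hit_pos
  by (intro add_left_mono sum_mono2) (auto intro: less_imp_le)

lemma impulse_time_unbounded: "\<exists>n. ereal t < impulse_time \<phi> D I x (Suc n)"
proof -
  have "ereal t < lifetime \<phi> D I x" by (simp add: lifetime_infinite)
  then show ?thesis
    unfolding lifetime_def less_SUP_iff by (metis Suc_le_D atLeast_iff One_nat_def)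
qed

lemma drift_before_hit: "ereal t < hit x \<Longrightarrow> drift t x = \<phi> t x"
  by (simp add: impulsive_semiflow_def)

text \<open>Since impulse times increase, the interval containing \<open>t\<close> is unique, so any index
  found by other means is the one picked in the definition.\<close>

lemma drift_eqI:
  assumes lo: "impulse_time \<phi> D I x (Suc n) \<le> ereal t"
    and hi: "ereal t < impulse_time \<phi> D I x (Suc (Suc n))"
  shows "drift t x =
    \<phi> (t - real_of_ereal (impulse_time \<phi> D I x (Suc n))) (I (impulse_point \<phi> D I x (Suc n)))"
proof -
  have "hit x \<le> ereal t"
    using impulse_time_mono[of "Suc 0" "Suc n" x] lo by (simp add: impulse_time_1)
  moreover have "(THE n. n \<ge> 1 \<and> impulse_time \<phi> D I x n \<le> ereal t
      \<and> ereal t < impulse_time \<phi> D I x (Suc n)) = Suc n"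
  proof (rule the_equality)
    fix m assume m: "m \<ge> 1 \<and> impulse_time \<phi> D I x m \<le> ereal t \<and> ereal t < impulse_time \<phi> D I x (Suc m)"
    show "m = Suc n"
    proof (rule ccontr)
      assume "m \<noteq> Suc n"
      then consider "Suc m \<le> Suc n" | "Suc (Suc n) \<le> m" by linarith
      then show False
        using m lo hi by cases (meson impulse_time_mono le_less_trans less_irrefl order_trans)+
    qed
  qed (use assms in simp)
  ultimately show ?thesis by (simp add: impulsive_semiflow_def not_less[symmetric] Let_def)
qed

text \<open>This recursion replaces the closed formula for the impulsive semiflow in everything that
  follows.\<close>

lemma drift_after_hit:
  assumes hit: "hit x = ereal r" and "r \<le> t"
  shows "drift t x = drift (t - r) (jump x)"
proof (cases "ereal (t - r) < hit (jump x)")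
  case True
  have "ereal t < impulse_time \<phi> D I x (Suc (Suc 0))"
    using True hit by (cases "hit (jump x)") (auto simp: impulse_time_Suc impulse_time_1)
  then have "drift t x = \<phi> (t - r) (jump x)"
    using drift_eqI[of x 0 t] assms by (simp add: impulse_time_1 jump_def)
  then show ?thesis using True by (simp add: drift_before_hit)
next
  case False
  let ?T = "impulse_time \<phi> D I (jump x)"
  \<comment> \<open>The least index with \<open>t - r < ?T (Suc n)\<close> gives the interval between impulses of \<open>jump x\<close>
    that contains \<open>t - r\<close>. For \<open>x\<close> the same interval appears shifted by \<open>r\<close>, with its index
    raised by one.\<close>
  define n where "n = (LEAST n. ereal (t - r) < ?T (Suc n))"
  have n: "ereal (t - r) < ?T (Suc n)"
    unfolding n_def using impulse_time_unbounded by (rule LeastI_ex)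
  then obtain k where k: "n = Suc k"
    using False by (cases n) (auto simp: impulse_time_1)
  then have lo: "?T (Suc k) \<le> ereal (t - r)"
    unfolding n_def by (metis lessI not_less not_less_Least)
  then obtain u where u: "?T (Suc k) = ereal u"
    using impulse_time_mono[of "Suc 0" "Suc k" "jump x"] first_hit_pos[of "jump x"]
    by (cases "?T (Suc k)") (auto simp: impulse_time_1)
  have "drift (t - r) (jump x) = \<phi> (t - r - u) (I (impulse_point \<phi> D I (jump x) (Suc k)))"
    using drift_eqI[OF lo] n k u by simp
  moreover have "drift t x = \<phi> (t - (r + u)) (I (impulse_point \<phi> D I x (Suc (Suc k))))"
  proof -
    have "impulse_time \<phi> D I x (Suc (Suc k)) = ereal (r + u)"
      using hit u by (simp add: impulse_time_Suc)
    moreover have "ereal t < impulse_time \<phi> D I x (Suc (Suc (Suc k)))"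
      using n k hit by (cases "?T (Suc (Suc k))") (auto simp: impulse_time_Suc[of x])
    ultimately show ?thesis
      using drift_eqI[of x "Suc k" t] lo u by simp
  qed
  ultimately show ?thesis by (simp only: impulse_point_Suc diff_diff_eq)
qed

text \<open>Before the first impulse both sides are governed by the same first impulse, which
  \<open>\<phi> t x\<close> meets at the same place as \<open>x\<close>, only \<open>t\<close> earlier. Otherwise the first impulse is cut off by
  \<open>drift_after_hit\<close>; the induction is on a bound for the number of impulses before \<open>t\<close>, finite
  because impulse times are unbounded.\<close>

lemma drift_add:
  assumes "0 \<le> s" "0 \<le> t"
  shows "drift (t + s) x = drift s (drift t x)"
proof -
  have before: "drift (t + s) x = drift s (drift t x)" if t: "0 \<le> t" "ereal t < hit x" for t x
  proof (cases "ereal (t + s) < hit x")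
    case True
    then have "ereal s < hit (\<phi> t x)"
      by (cases "hit x") (auto simp: hit_flow[OF t])
    then show ?thesis
      using True t assms semiflow_add[of s t x] by (simp add: drift_before_hit add.commute)
  next
    case False
    then obtain r where r: "hit x = ereal r" using first_hit_pos[of x] by (cases "hit x") auto
    have "hit (\<phi> t x) = ereal (r - t)" by (simp add: hit_flow[OF t] r)
    then have "drift s (\<phi> t x) = drift (s - (r - t)) (jump x)"
      using drift_after_hit[of "\<phi> t x" "r - t" s] jump_flow[OF t r] False r by simp
    moreover have "drift (t + s) x = drift (t + s - r) (jump x)"
      using drift_after_hit[OF r] False r by simp
    ultimately show ?thesis using t by (simp add: drift_before_hit algebra_simps)
  qed
  have "drift (t + s) x = drift s (drift t x)"
    if "0 \<le> t" "ereal t < impulse_time \<phi> D I x (Suc n)" for t x n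
    using that
  proof (induction n arbitrary: t x)
    case 0
    then show ?case using before by (simp add: impulse_time_1)
  next
    case (Suc n)
    show ?case
    proof (cases "ereal t < hit x")
      case True
      then show ?thesis using before Suc by blast
    next
      case False
      then obtain r where r: "hit x = ereal r" using first_hit_pos[of x] by (cases "hit x") auto
      have "ereal (t - r) < impulse_time \<phi> D I (jump x) (Suc n)"
        using Suc.prems r by (cases "impulse_time \<phi> D I (jump x) (Suc n)") (auto simp: impulse_time_Suc)
      then have "drift (t - r + s) (jump x) = drift s (drift (t - r) (jump x))"
        using Suc.IH[of "t - r" "jump x"] False r by simp
      then show ?thesis
        using drift_after_hit[OF r] False r assms by (simp add: algebra_simps)
    qed
  qed
  then show ?thesis using impulse_time_unbounded \<open>0 \<le> t\<close> by blast
qed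

section \<open>Uniform estimates from compactness\<close>

lemma flow_uniformly_close:
  assumes "compact (UNIV :: 'a set)" "0 < e"
  shows "\<exists>\<delta>>0. \<forall>t\<in>{0..<\<delta>}. \<forall>x. dist (\<phi> t x) x < e"
proof -
  have "compact ({0..1::real} \<times> (UNIV :: 'a set))"
    by (intro compact_Times assms) simp
  moreover have "continuous_on ({0..1} \<times> UNIV) (\<lambda>(t, x). \<phi> t x)"
    by (rule continuous_on_subset[OF semiflow_continuous]) auto
  ultimately have "uniformly_continuous_on ({0..1} \<times> UNIV) (\<lambda>(t, x). \<phi> t x)"
    by (rule compact_uniformly_continuous[rotated])
  then obtain d where d: "0 < d" "\<And>p q. p \<in> {0..1} \<times> UNIV \<Longrightarrow> q \<in> {0..1} \<times> UNIV \<Longrightarrow> dist q p < d \<Longrightarrow>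
      dist (case q of (t, x) \<Rightarrow> \<phi> t x) (case p of (t, x) \<Rightarrow> \<phi> t x) < e"
    using \<open>0 < e\<close> unfolding uniformly_continuous_on_def by metis
  show ?thesis
  proof (intro exI[of _ "min d 1"] conjI ballI allI)
    fix t x assume "t \<in> {0..<min d 1}"
    then show "dist (\<phi> t x) x < e"
      using d(2)[of "(0, x)" "(t, x)"] by (simp add: semiflow_0 dist_Pair_Pair dist_real_def)
  qed (use d in simp)
qed

text \<open>The impulses of an orbit are at least \<open>\<beta>\<close> apart: to reach \<open>D\<close> from \<open>I ` D\<close> the flow has to cover the
  positive distance between these compact sets, and it needs a time bounded below for this.\<close>

lemma hit_bounded_below_on_image:
  assumes "compact (UNIV :: 'a set)" "I ` D \<inter> D = {}"
  shows "\<exists>\<beta>>0. \<forall>p\<in>D. ereal \<beta> \<le> hit (I p)"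
proof -
  have "compact D" using assms closed_D by (metis Int_UNIV_left compact_Int_closed)
  then have "compact (I ` D)" using continuous_I by (rule compact_continuous_image[rotated])
  obtain e where e: "0 < e" "\<And>x y. x \<in> I ` D \<Longrightarrow> y \<in> D \<Longrightarrow> e \<le> dist x y"
  proof (cases "D = {}")
    case False
    have "continuous_on (I ` D) (\<lambda>x. infdist x D)" by (intro continuous_intros)
    then obtain p where p: "p \<in> I ` D" "\<And>x. x \<in> I ` D \<Longrightarrow> infdist p D \<le> infdist x D"
      using continuous_attains_inf[OF \<open>compact (I ` D)\<close>] False by blast
    have "p \<notin> D" using p(1) assms(2) by blast
    then have "0 < infdist p D"
      using in_closed_iff_infdist_zero[OF closed_D False, of p] infdist_nonneg[of p D] by linarith
    then show ?thesis
      using that p(2) by (meson infdist_le order_trans)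
  qed (use that[of 1] in simp)
  obtain \<beta> where \<beta>: "0 < \<beta>" "\<And>t x. t \<in> {0..<\<beta>} \<Longrightarrow> dist (\<phi> t x) x < e"
    using flow_uniformly_close[OF assms(1) e(1)] by blast
  have "ereal \<beta> \<le> hit (I p)" if "p \<in> D" for p
  proof (rule ccontr)
    assume "\<not> ereal \<beta> \<le> hit (I p)"
    then obtain r where r: "hit (I p) = ereal r" "r < \<beta>"
      using first_hit_pos[of "I p"] by (cases "hit (I p)") auto
    then have "\<phi> r (I p) \<in> D" "0 < r" using hit_finite_mem hit_finite_pos by auto
    then show False
      using e(2)[of "I p" "\<phi> r (I p)"] \<beta>(2)[of r "I p"] r that by (simp add: dist_commute)
  qed
  with \<beta> show ?thesis by blast
qed

text \<open>An orbit with an impulse before time \<open>\<delta>\<close> has no other one before time \<open>4 * \<delta>\<close>.\<close>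

lemma hit_after_jump:
  assumes gap: "\<And>p. p \<in> D \<Longrightarrow> ereal (4 * \<delta>) \<le> hit (I p)"
    and "0 < \<delta>" "hit q < ereal \<delta>" "\<delta> \<le> t" "t \<le> 3 * \<delta>"
  shows "ereal \<delta> \<le> hit (drift t q)"
proof -
  obtain r where r: "hit q = ereal r" "r < \<delta>" "0 < r"
    using assms(3) first_hit_pos[of q] by (cases "hit q") auto
  have "jump q = I (\<phi> r q)" by (simp add: jump_def r)
  then have "ereal (4 * \<delta>) \<le> hit (jump q)"
    using gap hit_finite_mem[OF r(1)] by simp
  moreover from this have "ereal (t - r) < hit (jump q)"
    by (rule less_le_trans[rotated]) (use assms r in simp)
  moreover have "drift t q = drift (t - r) (jump q)"
    using drift_after_hit[OF r(1)] assms r by simp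
  ultimately show ?thesis
    using hit_flow[of "t - r" "jump q"] assms r
    by (cases "hit (jump q)") (auto simp: drift_before_hit)
qed

text \<open>Pigeonhole: an impulse of an orbit in one of the four cells of length \<open>\<delta>\<close> excludes impulses in
  the later ones, so three orbits spoil at most three cells. The bound on \<open>hit\<close> says that the orbit
  follows the continuous semiflow throughout the cell that starts at time \<open>s\<close>.\<close>

lemma three_orbits_common_free_cell:
  assumes gap: "\<And>p. p \<in> D \<Longrightarrow> ereal (4 * \<delta>) \<le> hit (I p)" and "0 < \<delta>"
  shows "\<exists>s\<in>{0..3 * \<delta>}. \<forall>p\<in>{x, y, z}. ereal \<delta> \<le> hit (drift s p)"
proof -
  have once: "ereal \<delta> \<le> hit (drift (real j * \<delta>) p)"
    if "\<not> ereal \<delta> \<le> hit (drift (real i * \<delta>) p)" "i < j" "j \<le> 3" for i j p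
  proof -
    let ?q = "drift (real i * \<delta>) p"
    have "real j * \<delta> = real i * \<delta> + real (j - i) * \<delta>"
      using that by (simp add: algebra_simps of_nat_diff)
    then have "drift (real j * \<delta>) p = drift (real (j - i) * \<delta>) ?q"
      using drift_add[of "real (j - i) * \<delta>" "real i * \<delta>" p] \<open>0 < \<delta>\<close> by simp
    moreover have "\<delta> \<le> real (j - i) * \<delta>" "real (j - i) * \<delta> \<le> 3 * \<delta>"
      using that \<open>0 < \<delta>\<close> by auto
    ultimately show ?thesis
      using hit_after_jump[OF gap \<open>0 < \<delta>\<close>, of ?q] that by (simp add: not_le)
  qed
  define bad where "bad p = {i \<in> {..<4::nat}. \<not> ereal \<delta> \<le> hit (drift (real i * \<delta>) p)}" for p
  have card_bad: "card (bad p) \<le> 1" for p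
  proof -
    have "i = j" if "i \<in> bad p" "j \<in> bad p" for i j
      using that once[of i p j] once[of j p i] unfolding bad_def by (cases i j rule: linorder_cases) auto
    moreover have "finite (bad p)" by (simp add: bad_def)
    ultimately show ?thesis by (simp add: card_le_Suc0_iff_eq)
  qed
  have "card (bad x \<union> bad y \<union> bad z) \<le> 3"
    using card_Un_le[of "bad x \<union> bad y" "bad z"] card_Un_le[of "bad x" "bad y"]
      card_bad[of x] card_bad[of y] card_bad[of z] by linarith
  moreover have cells: "bad x \<union> bad y \<union> bad z \<subseteq> {..<4}" by (auto simp: bad_def)
  ultimately have "bad x \<union> bad y \<union> bad z \<noteq> {..<4}" by auto
  then obtain i where i: "i < 4" "i \<notin> bad x \<union> bad y \<union> bad z"
    using cells by blast
  then have "real i * \<delta> \<in> {0..3 * \<delta>}" using \<open>0 < \<delta>\<close> by simp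
  then show ?thesis using i unfolding bad_def by auto
qed

section \<open>Comparison of the entropies\<close>

text \<open>At the start \<open>t + s\<close> of a common free cell, \<open>x\<close> is within \<open>3 * \<epsilon>\<close> of \<open>z\<close>: one \<open>\<epsilon>\<close> comes from
  \<open>dist_bar\<close>, and one for each of the two points from moving along the flow for a time below \<open>\<delta>\<close>. The same holds for
  \<open>y\<close>. Since \<open>s < 4 * \<delta>\<close>, this time is admissible for \<open>dist_hat\<close>; but \<open>t + s\<close> may exceed
  \<open>T\<close>, so shadowing is assumed a little longer.\<close>

lemma common_shadowing_imp_dist_hat_less:
  assumes gap: "\<And>p. p \<in> D \<Longrightarrow> ereal (4 * \<delta>) \<le> hit (I p)" and "0 < \<delta>"
    and small: "\<And>t x. t \<in> {0..<\<delta>} \<Longrightarrow> dist (\<phi> t x) x < \<epsilon>"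
    and xz: "\<forall>t\<in>{0..T + 4 * \<delta>}. dist_bar drift \<delta> (drift t x) (drift t z) < \<epsilon>"
    and yz: "\<forall>t\<in>{0..T + 4 * \<delta>}. dist_bar drift \<delta> (drift t y) (drift t z) < \<epsilon>"
    and t: "t \<in> {0..T}"
  shows "dist_hat drift (4 * \<delta>) (drift t x) (drift t y) < 6 * \<epsilon>"
proof -
  obtain s where s: "s \<in> {0..3 * \<delta>}"
    and free: "\<And>p. p \<in> {drift t x, drift t y, drift t z} \<Longrightarrow> ereal \<delta> \<le> hit (drift s p)"
    using three_orbits_common_free_cell[OF gap \<open>0 < \<delta>\<close>] by metis
  have a: "t + s \<in> {0..T + 4 * \<delta>}" using s t \<open>0 < \<delta>\<close> by simp
  have add: "drift (t + s) p = drift s (drift t p)" for p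
    using drift_add[of s t p] s t by simp
  have close: "dist (drift s (drift t p)) (drift s (drift t z)) < 3 * \<epsilon>"
    if p: "p \<in> {x, y}" for p
  proof -
    let ?u = "drift s (drift t p)" and ?v = "drift s (drift t z)"
    have "dist_bar drift \<delta> ?u ?v < \<epsilon>"
      using bspec[OF xz a] bspec[OF yz a] p by (auto simp: add)
    then obtain s1 s2 where *: "s1 \<in> {0..<\<delta>}" "s2 \<in> {0..<\<delta>}" "dist (drift s1 ?u) (drift s2 ?v) < \<epsilon>"
      using \<open>0 < \<delta>\<close> by (auto simp: dist_bar_less_iff)
    have "ereal s1 < hit ?u" "ereal s2 < hit ?v"
      using * p by (auto intro!: less_le_trans[OF _ free])
    then have "dist (\<phi> s1 ?u) (\<phi> s2 ?v) < \<epsilon>"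
      using * by (simp add: drift_before_hit)
    moreover have "dist (\<phi> s1 ?u) ?u < \<epsilon>" "dist (\<phi> s2 ?v) ?v < \<epsilon>"
      using * small by auto
    ultimately show ?thesis
      by metric
  qed
  have "dist (drift s (drift t x)) (drift s (drift t y)) < 6 * \<epsilon>"
    using close[of x] close[of y] by simp metric
  then show ?thesis
    using s \<open>0 < \<delta>\<close> by (auto simp: dist_hat_less_iff intro!: bexI[of _ s])
qed

text \<open>The cell length \<open>\<delta>'\<close> has to meet three demands: four cells fit between impulses, four cells fit into
  the window \<open>\<delta>\<close> of \<open>dist_hat\<close>, and the flow moves points by less than \<open>\<epsilon> / 6\<close> during one cell.\<close>

lemma sep_num_hat_le_span_num_bar:
  assumes "compact (UNIV :: 'a set)" "I ` D \<inter> D = {}" "0 < \<epsilon>" "0 < \<delta>"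
  shows "\<exists>\<epsilon>'>0. \<exists>\<delta>'>0. \<exists>c. \<forall>T>0.
    sep_num (dist_hat drift \<delta>) drift T \<epsilon> \<le> span_num (dist_bar drift \<delta>') drift (T + c) \<epsilon>'"
proof -
  obtain \<beta> where \<beta>: "0 < \<beta>" "\<And>p. p \<in> D \<Longrightarrow> ereal \<beta> \<le> hit (I p)"
    using hit_bounded_below_on_image[OF assms(1,2)] by blast
  define \<epsilon>' where "\<epsilon>' = \<epsilon> / 6"
  have "0 < \<epsilon>'" "6 * \<epsilon>' = \<epsilon>" using assms by (auto simp: \<epsilon>'_def)
  obtain \<gamma> where \<gamma>: "0 < \<gamma>" "\<And>t x. t \<in> {0..<\<gamma>} \<Longrightarrow> dist (\<phi> t x) x < \<epsilon>'"
    using flow_uniformly_close[OF assms(1) \<open>0 < \<epsilon>'\<close>] by blast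
  define \<delta>' where "\<delta>' = min \<gamma> (min \<beta> \<delta> / 4)"
  have \<delta>': "0 < \<delta>'" "4 * \<delta>' \<le> \<beta>" "4 * \<delta>' \<le> \<delta>" "\<delta>' \<le> \<gamma>"
    using assms \<beta> \<gamma> by (auto simp: \<delta>'_def)
  have gap: "ereal (4 * \<delta>') \<le> hit (I p)" if "p \<in> D" for p
    by (rule order_trans[OF _ \<beta>(2)[OF that]]) (use \<delta>' in simp)
  have "sep_num (dist_hat drift \<delta>) drift T \<epsilon> \<le> span_num (dist_bar drift \<delta>') drift (T + 4 * \<delta>') \<epsilon>'" for T
  proof (rule sep_num_le_span_num, rule ballI)
    fix x y z t
    assume "\<forall>t\<in>{0..T + 4 * \<delta>'}. dist_bar drift \<delta>' (drift t x) (drift t z) < \<epsilon>'"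
      and "\<forall>t\<in>{0..T + 4 * \<delta>'}. dist_bar drift \<delta>' (drift t y) (drift t z) < \<epsilon>'"
      and "t \<in> {0..T}"
    then have "dist_hat drift (4 * \<delta>') (drift t x) (drift t y) < 6 * \<epsilon>'"
      using \<delta>' \<gamma> by (intro common_shadowing_imp_dist_hat_less[OF gap]) auto
    then show "dist_hat drift \<delta> (drift t x) (drift t y) < \<epsilon>"
      using dist_hat_antimono[of "4 * \<delta>'" \<delta>] \<delta>' \<open>6 * \<epsilon>' = \<epsilon>\<close> by (smt (verit))
  qed
  then show ?thesis using \<open>0 < \<epsilon>'\<close> \<delta>'(1) by blast
qed

end

theorem theorem3:
  fixes \<phi> \<psi> :: "real \<Rightarrow> 'a::metric_space \<Rightarrow> 'a"
    and D :: "'a set" and I :: "'a \<Rightarrow> 'a"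
  assumes "compact (UNIV :: 'a set)"
    and "regular_impulsive_system \<phi> D I"
    and "\<psi> = impulsive_semiflow \<phi> D I"
  shows "h_r_bar \<psi> = h_s_bar \<psi> \<and> h_s_bar \<psi> = h_r_hat \<psi> \<and> h_r_hat \<psi> = h_s_hat \<psi>"
proof -
  interpret regular_impulsive_system \<phi> D I by fact
  have antimono:
    "count_antimono (\<lambda>T \<epsilon> \<delta>. span_num (dist_bar \<psi> \<delta>) \<psi> T \<epsilon>)"
    "count_antimono (\<lambda>T \<epsilon> \<delta>. sep_num (dist_bar \<psi> \<delta>) \<psi> T \<epsilon>)"
    "count_antimono (\<lambda>T \<epsilon> \<delta>. span_num (dist_hat \<psi> \<delta>) \<psi> T \<epsilon>)"
    "count_antimono (\<lambda>T \<epsilon> \<delta>. sep_num (dist_hat \<psi> \<delta>) \<psi> T \<epsilon>)"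
    unfolding count_antimono_def
    by (intro allI impI span_num_mono sep_num_mono dist_bar_antimono dist_hat_antimono; assumption)+
  have "h_r_bar \<psi> \<le> h_s_bar \<psi>" "h_r_hat \<psi> \<le> h_s_hat \<psi>"
    unfolding h_r_bar_def h_s_bar_def h_r_hat_def h_s_hat_def
    by (intro growth_rate_mono antimono span_num_le_sep_num dist_bar_refl_less dist_hat_refl_less
        dist_bar_commute dist_hat_commute; simp)+
  moreover have "h_r_bar \<psi> \<le> h_r_hat \<psi>" "h_s_bar \<psi> \<le> h_s_hat \<psi>"
    unfolding h_r_bar_def h_s_bar_def h_r_hat_def h_s_hat_def
    by (intro growth_rate_mono antimono span_num_mono sep_num_mono dist_bar_le_dist_hat; simp)+
  moreover have "h_s_hat \<psi> \<le> h_r_bar \<psi>"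
    unfolding h_r_bar_def h_s_hat_def
    using sep_num_hat_le_span_num_bar[OF assms(1) disjoint_I]
    by (intro growth_rate_le antimono) (simp add: assms(3))
  ultimately show ?thesis by (metis antisym order_trans)
qed

end
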